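(* Let $W\ge 2$ be an integer and let $\mathbf{W}=(w_{i,j})_{i,j=0}^{W}$ be the AR(2) matrix (defined in the context) with parameters $\phi_1,\phi_2$ such that $|\phi_1|=2$ and $\phi_2=-1$. Let $1+t+\dots+t^{W-2}=\mathsf{p}(t)\mathsf{q}(t)$ be a factorization into a product of two real polynomials with non-negative coefficients, let $A=\deg\mathsf{p}+1$, $B=\deg\mathsf{q}+1$ and $\beta=-\phi_1/2=-\operatorname{sign}(\phi_1)$. Let $\mathbf{A}=(a_{i,j})_{i,j=0}^{A}$ and $\mathbf{B}=(b_{i,j})_{i,j=0}^{B}$ be the symmetric 3-diagonal matrices whose diagonals have generating functions $$\mathsf{a}_0(t)=(1+t)\mathsf{p}(t),\quad \mathsf{a}_1(t)=\beta\mathsf{p}(t),\quad \mathsf{b}_0(t)=(1+t)\mathsf{q}(t),\quad \mathsf{b}_1(t)=\beta\mathsf{q}(t).$$ Then both $\mathbf{A}$ and $\mathbf{B}$ are non-negative definite and $\mathbf{W}=\mathbf{A}\ast\mathbf{B}$.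
   Context: AR(2) matrix: for $W\ge 3$, $\mathbf{W}=(w_{i,j})_{i,j=0}^{W}$ is the symmetric matrix with $w_{i,j}=0$ for $|i-j|>2$ such that - $w_{i,i+2}=-\phi_2$ for $0\le i\le W-2$; - $w_{0,1}=w_{W-1,W}=-\phi_1$ and $w_{i,i+1}=-\phi_1+\phi_1\phi_2$ for $1\le i\le W-2$; - $w_{0,0}=w_{W,W}=1$, $w_{1,1}=w_{W-1,W-1}=1+\phi_1^2$, and $w_{i,i}=1+\phi_1^2+\phi_2^2$ for $2\le i\le W-2$. For $W=2$ it is the symmetric $3\times 3$ matrix with $w_{0,0}=w_{2,2}=1$, $w_{1,1}=1+\phi_1^2-\phi_2^2$, $w_{0,1}=w_{1,2}=-\phi_1$, $w_{0,2}=-\phi_2$. Generating functions of diagonals: $\mathsf{a}_0(t)=\sum_{j=0}^{A}a_{j,j}t^j$, $\mathsf{a}_1(t)=\sum_{j=0}^{A-1}a_{j,j+1}t^j$, and similarly for $\mathbf{B}$. A matrix is 3-diagonal if its $(i,j)$ entries vanish for $|i-j|>1$. Matrix convolution: for $\mathbf{A}=(a_{i,j})_{i,j=0}^{A}$ and $\mathbf{B}=(b_{i,j})_{i,j=0}^{B}$ the matrix $\mathbf{C}=\mathbf{A}\ast\mathbf{B}=(c_{i,j})_{i,j=0}^{A+B}$ has entries $c_{i,j}=\sum_{k,l}a_{k,l}\,b_{i-k,j-l}$, the sum being over all $k,l$ with $\max\{0,i-B\}\le k\le\min\{A,i\}$, $\max\{0,j-B\}\le l\le\min\{A,j\}$.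 *)

theory Defs
  imports Complex_Main "HOL-Computational_Algebra.Polynomial" "Jordan_Normal_Form.Matrix"
begin

definition symmetric_matrix :: "'a mat \<Rightarrow> bool" where
  "symmetric_matrix M \<longleftrightarrow> transpose_mat M = M"

definition nonneg_definite :: "real mat \<Rightarrow> bool" where
  "nonneg_definite M \<longleftrightarrow>
     symmetric_matrix M \<and> (\<forall>v \<in> carrier_vec (dim_row M). 0 \<le> v \<bullet> (M *\<^sub>v v))"

definition three_diagonal :: "'a::zero mat \<Rightarrow> bool" where
  "three_diagonal M \<longleftrightarrow>
     (\<forall>i < dim_row M. \<forall>j < dim_col M. \<bar>int i - int j\<bar> > 1 \<longrightarrow> M $$ (i, j) = 0)"

text \<open>Generating function of the \<open>k\<close>-th superdiagonal of a square matrix.\<close>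

definition diag_gf :: "nat \<Rightarrow> real mat \<Rightarrow> real poly" where
  "diag_gf k M = (\<Sum>j < dim_row M - k. monom (M $$ (j, j + k)) j)"

text \<open>
  A square matrix with indices \<open>0..m\<close> has dimension \<open>m + 1\<close>, so the convolution of matrices of
  dimensions \<open>m + 1\<close> and \<open>n + 1\<close> has dimension \<open>m + n + 1\<close>.  Subtraction on \<open>nat\<close> truncates,
  hence the lower summation bound \<open>i - n\<close> is \<open>max 0 (i - n)\<close>.
\<close>

definition mat_conv :: "real mat \<Rightarrow> real mat \<Rightarrow> real mat" (infixl \<open>\<star>\<close> 70) where
  "M \<star> N =
     (let m = dim_row M - 1; n = dim_row N - 1 in
      mat (m + n + 1) (m + n + 1) (\<lambda>(i, j).
        \<Sum>k = i - n..min m i. \<Sum>l = j - n..min m j. M $$ (k, l) * N $$ (i - k, j - l)))"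

text \<open>The entry at \<open>(i, i + d)\<close> of the AR(2) matrix with indices \<open>0..W\<close>, for \<open>W \<ge> 3\<close>.\<close>

definition ar2_diag_entry :: "nat \<Rightarrow> real \<Rightarrow> real \<Rightarrow> nat \<Rightarrow> nat \<Rightarrow> real" where
  "ar2_diag_entry W \<phi>\<^sub>1 \<phi>\<^sub>2 d i =
     (if d = 0 then
        (if i = 0 \<or> i = W then 1
         else if i = 1 \<or> i = W - 1 then 1 + \<phi>\<^sub>1^2
         else 1 + \<phi>\<^sub>1^2 + \<phi>\<^sub>2^2)
      else if d = 1 then
        (if i = 0 \<or> i = W - 1 then - \<phi>\<^sub>1 else - \<phi>\<^sub>1 + \<phi>\<^sub>1 * \<phi>\<^sub>2)
      else if d = 2 then - \<phi>\<^sub>2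
      else 0)"

text \<open>Only meaningful for \<open>W \<ge> 2\<close>.\<close>

definition ar2_mat :: "nat \<Rightarrow> real \<Rightarrow> real \<Rightarrow> real mat" where
  "ar2_mat W \<phi>\<^sub>1 \<phi>\<^sub>2 =
     (if W = 2 then
        mat_of_rows_list 3
          [[1, - \<phi>\<^sub>1, - \<phi>\<^sub>2],
           [- \<phi>\<^sub>1, 1 + \<phi>\<^sub>1^2 - \<phi>\<^sub>2^2, - \<phi>\<^sub>1],
           [- \<phi>\<^sub>2, - \<phi>\<^sub>1, 1]]
      else
        mat (W + 1) (W + 1) (\<lambda>(i, j).
          ar2_diag_entry W \<phi>\<^sub>1 \<phi>\<^sub>2 (max i j - min i j) (min i j)))"

end

theory Submission
  imports Defs
begin

text \<open>
  To a matrix \<open>M\<close> attach the bivariate polynomial \<open>\<Sum>i j. M\<^sub>i\<^sub>j s\<^sup>i t\<^sup>j\<close>; convolution of matrices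
  becomes multiplication of polynomials.  As \<open>\<beta>\<^sup>2 = 1\<close>, the polynomial of \<open>\<^bold>A\<close> is
  \<open>p(st) (1 + st + \<beta>s + \<beta>t) = p(st) (1 + \<beta>s) (1 + \<beta>t)\<close>.  This exhibits \<open>\<^bold>A\<close> as a combination
  of rank-one squares with the non-negative weights \<open>p\<^sub>k\<close>, and gives \<open>\<^bold>A \<star> \<^bold>B\<close> the polynomial
  \<open>(pq)(st) (1 + \<beta>s)\<^sup>2 (1 + \<beta>t)\<^sup>2\<close>, which is that of the AR(2) matrix.
\<close>

text \<open>The outer variable of \<open>real poly poly\<close> is \<open>s\<close> (row index), the inner one is \<open>t\<close>.\<close>

definition mat_gf :: "real mat \<Rightarrow> real poly poly" where
  "mat_gf M = (\<Sum>i<dim_row M. monom (\<Sum>j<dim_col M. monom (M $$ (i, j)) j) i)"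

lemma coeff_mat_gf:
  "coeff (coeff (mat_gf M) i) j = (if i < dim_row M \<and> j < dim_col M then M $$ (i, j) else 0)"
  by (simp add: mat_gf_def coeff_sum if_distrib[of "\<lambda>x. coeff x j"] cong: if_cong)

text \<open>The dimensions are fixed beforehand because \<open>mat_gf\<close> cannot see trailing
  zero rows and columns.\<close>

lemma mat_gf_inject:
  assumes "M \<in> carrier_mat m n" "N \<in> carrier_mat m n" "mat_gf M = mat_gf N"
  shows "M = N"
proof (rule eq_matI)
  fix i j assume "i < dim_row N" "j < dim_col N"
  then show "M $$ (i, j) = N $$ (i, j)"
    using assms coeff_mat_gf[of M i j] coeff_mat_gf[of N i j] by auto
qed (use assms in auto)

text \<open>The index bounds in \<open>mat_conv\<close> cut the Cauchy sum down to the pairs where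
  both matrices have entries; every discarded term contains a coefficient outside one of the
  matrices and is 0.\<close>

lemma mat_gf_conv:
  assumes M: "M \<in> carrier_mat (m + 1) (m + 1)" and N: "N \<in> carrier_mat (n + 1) (n + 1)"
  shows "mat_gf (M \<star> N) = mat_gf M * mat_gf N"
proof (intro poly_eqI)
  fix i j
  let ?f = "\<lambda>k l. coeff (coeff (mat_gf M) k) l * coeff (coeff (mat_gf N) (i - k)) (j - l)"
  have "coeff (coeff (mat_gf M * mat_gf N) i) j = (\<Sum>k\<le>i. \<Sum>l\<le>j. ?f k l)"
    by (simp add: coeff_mult coeff_sum)
  also have "\<dots> = (\<Sum>k = i - n..min m i. \<Sum>l\<le>j. ?f k l)"
    using M N by (intro sum.mono_neutral_right) (auto simp: coeff_mat_gf intro!: sum.neutral)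
  also have "\<dots> = (\<Sum>k = i - n..min m i. \<Sum>l = j - n..min m j. ?f k l)"
    using M N by (intro sum.cong refl sum.mono_neutral_right) (auto simp: coeff_mat_gf)
  also have "\<dots> = (\<Sum>k = i - n..min m i. \<Sum>l = j - n..min m j. M $$ (k, l) * N $$ (i - k, j - l))"
    using M N by (intro sum.cong refl) (auto simp: coeff_mat_gf)
  also have "\<dots> = coeff (coeff (mat_gf (M \<star> N)) i) j"
    using M N by (auto simp: coeff_mat_gf mat_conv_def Let_def)
  finally show "coeff (coeff (mat_gf (M \<star> N)) i) j = coeff (coeff (mat_gf M * mat_gf N) i) j"
    by simp
qed

text \<open>The bivariate polynomial \<open>p(st)\<close>.\<close>

definition diag_poly :: "real poly \<Rightarrow> real poly poly" where
  "diag_poly p = (\<Sum>k\<le>degree p. monom (monom (coeff p k) k) k)"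

lemma coeff_diag_poly:
  "coeff (coeff (diag_poly p) i) j = (if i = j then coeff p i else 0)"
  by (auto simp: diag_poly_def coeff_sum coeff_eq_0 if_distrib[of "\<lambda>x. coeff x j"] cong: if_cong)

text \<open>Substituting st for the variable is multiplicative. In the double Cauchy sum only l = k
  survives, and then i - k = j - l forces i = j.\<close>

lemma diag_poly_mult: "diag_poly (p * q) = diag_poly p * diag_poly q"
proof (intro poly_eqI)
  fix i j
  have "coeff (coeff (diag_poly p * diag_poly q) i) j
      = (\<Sum>k\<le>i. \<Sum>l\<le>j. coeff (coeff (diag_poly p) k) l * coeff (coeff (diag_poly q) (i - k)) (j - l))"
    by (simp add: coeff_mult coeff_sum)
  also have "\<dots> = (\<Sum>k\<le>i. \<Sum>l\<le>j. if l = k then coeff p k * (if i = j then coeff q (i - k) else 0) else 0)"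
    by (intro sum.cong refl) (auto simp: coeff_diag_poly)
  also have "\<dots> = coeff (coeff (diag_poly (p * q)) i) j"
    by (auto simp: coeff_diag_poly coeff_mult intro!: sum.neutral)
  finally show "coeff (coeff (diag_poly (p * q)) i) j = coeff (coeff (diag_poly p * diag_poly q) i) j"
    by simp
qed

lemma coeff_diag_gf:
  "coeff (diag_gf k M) j = (if j < dim_row M - k then M $$ (j, j + k) else 0)"
  by (simp add: diag_gf_def coeff_sum)

lemma three_diagonal_entries:
  assumes M: "M \<in> carrier_mat (degree p + 2) (degree p + 2)"
    and sym: "symmetric_matrix M" and tri: "three_diagonal M"
    and d0: "diag_gf 0 M = [:1, 1:] * p" and d1: "diag_gf 1 M = Polynomial.smult \<beta> p"
    and i: "i < degree p + 2" and j: "j < degree p + 2"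
  shows "M $$ (i, j) = (if i = j then coeff p i + (if i = 0 then 0 else coeff p (i - 1))
      else if j = i + 1 then \<beta> * coeff p i else if i = j + 1 then \<beta> * coeff p j else 0)"
proof -
  have sw: "M $$ (i, j) = M $$ (j, i)"
    using sym M i j unfolding symmetric_matrix_def by (metis carrier_matD index_transpose_mat(1))
  have D0: "M $$ (i, i) = coeff p i + (if i = 0 then 0 else coeff p (i - 1))"
    using arg_cong[OF d0, of "\<lambda>r. coeff r i"] M i
    by (auto simp: coeff_diag_gf coeff_pCons split: nat.splits)
  have D1: "M $$ (k, Suc k) = \<beta> * coeff p k" if "Suc k < degree p + 2" for k
    using arg_cong[OF d1, of "\<lambda>r. coeff r k"] M that by (simp add: coeff_diag_gf)
  have "M $$ (i, j) = 0" if "\<bar>int i - int j\<bar> > 1"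
    using tri M i j that by (auto simp: three_diagonal_def)
  then show ?thesis
    using D0 D1[of i] D1[of j] sw i j by auto
qed

text \<open>The quadratic form of such a matrix is a sum of squares of the linear forms
  \<open>u k\<close>, weighted by \<open>w k\<close>.\<close>

lemma weighted_gram_nonneg_definite:
  assumes M: "M \<in> carrier_mat n n" and w: "\<And>k. k \<in> K \<Longrightarrow> 0 \<le> w k"
    and gram: "\<And>i j. i < n \<Longrightarrow> j < n \<Longrightarrow> M $$ (i, j) = (\<Sum>k\<in>K. w k * u k i * u k j)"
  shows "nonneg_definite M"
  unfolding nonneg_definite_def
proof (intro conjI ballI)
  show "symmetric_matrix M"
    unfolding symmetric_matrix_def
    by (rule eq_matI) (use M in \<open>auto simp: gram mult_ac\<close>)
  fix v :: "real vec" assume "v \<in> carrier_vec (dim_row M)"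
  then have v: "dim_vec v = n" using M by simp
  have "v \<bullet> (M *\<^sub>v v) = (\<Sum>i<n. \<Sum>j<n. \<Sum>k\<in>K. w k * ((u k i * v $ i) * (u k j * v $ j)))"
    using M v
    by (simp add: scalar_prod_def gram sum_distrib_left sum_distrib_right mult_ac atLeast0LessThan)
  also have "\<dots> = (\<Sum>i<n. \<Sum>k\<in>K. \<Sum>j<n. w k * ((u k i * v $ i) * (u k j * v $ j)))"
    by (intro sum.cong refl sum.swap)
  also have "\<dots> = (\<Sum>k\<in>K. \<Sum>i<n. \<Sum>j<n. w k * ((u k i * v $ i) * (u k j * v $ j)))"
    by (rule sum.swap)
  also have "\<dots> = (\<Sum>k\<in>K. w k * (\<Sum>i<n. u k i * v $ i)\<^sup>2)"
    by (simp add: power2_eq_square sum_product flip: sum_distrib_left)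
  also have "\<dots> \<ge> 0" by (intro sum_nonneg mult_nonneg_nonneg w) auto
  finally show "0 \<le> v \<bullet> (M *\<^sub>v v)" .
qed

lemma three_diagonal_nonneg_definite:
  assumes M: "M \<in> carrier_mat (degree p + 2) (degree p + 2)"
    and sym: "symmetric_matrix M" and tri: "three_diagonal M"
    and d0: "diag_gf 0 M = [:1, 1:] * p" and d1: "diag_gf 1 M = Polynomial.smult \<beta> p"
    and \<beta>: "\<beta> * \<beta> = 1" and p: "\<And>i. coeff p i \<ge> 0"
  shows "nonneg_definite M"
proof (rule weighted_gram_nonneg_definite[OF M])
  \<comment> \<open>The coefficient vector of s^k (1 + \<beta>s), so that the k-th summand of p(st)
    (1 + \<beta>s) (1 + \<beta>t) is \<open>coeff p k\<close> times a rank-one square.\<close>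
  let ?u = "\<lambda>k i. if i = k then 1 else if i = Suc k then \<beta> else 0"
  fix i j assume ij: "i < degree p + 2" "j < degree p + 2"
  \<comment> \<open>Only k = i and k = i - 1 contribute, and the range contains both; indices above
    \<open>degree p\<close> carry weight 0. The guard \<open>i = 0\<close> stops truncated
    subtraction from counting k = 0 twice.\<close>
  have "(\<Sum>k\<le>degree p + 2. coeff p k * ?u k i * ?u k j)
      = (\<Sum>k\<le>degree p + 2. (if k = i then coeff p i * ?u i j else 0)
          + (if k = i - 1 then (if i = 0 then 0 else \<beta> * coeff p (i - 1) * ?u (i - 1) j) else 0))"
    by (intro sum.cong refl) auto
  also have "\<dots> = coeff p i * ?u i j + (if i = 0 then 0 else \<beta> * coeff p (i - 1) * ?u (i - 1) j)"
    using ij by (auto simp: sum.distrib)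
  also have "\<dots> = M $$ (i, j)"
    unfolding three_diagonal_entries[OF M sym tri d0 d1 ij] using \<beta> by auto
  finally show "M $$ (i, j) = (\<Sum>k\<le>degree p + 2. coeff p k * ?u k i * ?u k j)" ..
qed (rule p)

lemma three_diagonal_mat_gf:
  assumes M: "M \<in> carrier_mat (degree p + 2) (degree p + 2)"
    and sym: "symmetric_matrix M" and tri: "three_diagonal M"
    and d0: "diag_gf 0 M = [:1, 1:] * p" and d1: "diag_gf 1 M = Polynomial.smult \<beta> p"
    and \<beta>: "\<beta> * \<beta> = 1"
  shows "mat_gf M = diag_poly p * ([:1, [:\<beta>:]:] * [:[:1, \<beta>:]:])"
proof (intro poly_eqI)
  fix i j
  have "coeff (coeff (diag_poly p * ([:1, [:\<beta>:]:] * [:[:1, \<beta>:]:])) i) j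
     = (if i = j then coeff p i + (if i = 0 then 0 else coeff p (i - 1))
      else if j = i + 1 then \<beta> * coeff p i else if i = j + 1 then \<beta> * coeff p j else 0)"
    using \<beta> by (cases i; cases j) (auto simp: coeff_diag_poly coeff_pCons algebra_simps split: nat.splits)
  \<comment> \<open>Outside the matrix the formula involves only coefficients of p beyond its
    degree, so both sides are 0 there.\<close>
  then show "coeff (coeff (mat_gf M) i) j
      = coeff (coeff (diag_poly p * ([:1, [:\<beta>:]:] * [:[:1, \<beta>:]:])) i) j"
    using M by (auto simp: coeff_mat_gf three_diagonal_entries[OF M sym tri d0 d1] coeff_eq_0)
qed

text \<open>Since \<beta>^2 = 1, the two kernels are (1 + \<beta>s)^2 and (1 + \<beta>t)^2. The 4 on
  the diagonal is (2\<beta>)^2.\<close>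

lemma coeff_diag_poly_five_diagonal:
  assumes \<beta>: "\<beta> * \<beta> = 1"
  shows "coeff (coeff (diag_poly r * ([:1, [:2 * \<beta>:], 1:] * [:[:1, 2 * \<beta>, 1:]:])) i) j =
     (if i = j then coeff r i + (if i = 0 then 0 else 4 * coeff r (i - 1))
        + (if i < 2 then 0 else coeff r (i - 2))
      else if j = i + 1 then 2 * \<beta> * (coeff r i + (if i = 0 then 0 else coeff r (i - 1)))
      else if i = j + 1 then 2 * \<beta> * (coeff r j + (if j = 0 then 0 else coeff r (j - 1)))
      else if j = i + 2 then coeff r i
      else if i = j + 2 then coeff r j else 0)" (is "?c = ?rhs")
proof -
  let ?k = "[:1, 2 * \<beta>, 1:]"
  have diag: "coeff (diag_poly r) n = monom (coeff r n) n" for n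
    by (intro poly_eqI) (auto simp: coeff_diag_poly)
  have k: "coeff ?k n = (if n = 0 then 1 else if n = 1 then 2 * \<beta> else if n = 2 then 1 else 0)"
    "coeff (Polynomial.smult (2 * \<beta>) ?k) n
      = (if n = 0 then 2 * \<beta> else if n = 1 then 4 else if n = 2 then 2 * \<beta> else 0)" for n
    using \<beta> by (auto simp: coeff_pCons split: nat.splits)
  have K: "[:1, [:2 * \<beta>:], 1:] * [:?k:] = [:?k, Polynomial.smult (2 * \<beta>) ?k, ?k:]"
    by simp
  \<comment> \<open>The kernel has degree 2 in s, so row i of the product combines rows i, i - 1 and
    i - 2 of \<open>diag_poly r\<close>, each a single monomial in t.\<close>
  have row: "coeff (D * [:a, b, c:]) i = coeff D i * a
      + (if i = 0 then 0 else coeff D (i - 1) * b) + (if i < 2 then 0 else coeff D (i - 2) * c)"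
    for D :: "real poly poly" and a b c
    by (auto simp: coeff_pCons mult_ac split: nat.splits)
  have "?c = (if j < i then 0 else coeff r i * coeff ?k (j - i))
      + (if i = 0 \<or> j < i - 1 then 0
         else coeff r (i - 1) * coeff (Polynomial.smult (2 * \<beta>) ?k) (j - (i - 1)))
      + (if i < 2 \<or> j < i - 2 then 0 else coeff r (i - 2) * coeff ?k (j - (i - 2)))"
    unfolding K row diag
    by (auto simp: coeff_monom_mult
        simp del: mult_pCons_right mult_pCons_left mult_smult_right smult_pCons coeff_smult)
  also have "\<dots> = ?rhs"
  proof -
    consider "j + 2 < i" | "i = j + 2" | "i = j + 1" | "j = i" | "j = i + 1" | "j = i + 2" | "j > i + 2"
      by linarith
    then show ?thesis
      unfolding k by cases (auto simp: algebra_simps)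
  qed
  finally show ?thesis .
qed

text \<open>Here the coefficients of r are 1 up to W - 2 and 0 afterwards. For W \<ge> 3 the
  diagonal r_i + 4 r_(i-1) + r_(i-2) thus takes the values 1, 5, 6, ..., 6, 5, 1, and the next one
  2\<beta> (r_i + r_(i-1)) the values 2\<beta>, 4\<beta>, ..., 4\<beta>, 2\<beta>.\<close>

lemma ar2_mat_gf:
  assumes W: "W \<ge> 2" and \<beta>: "\<beta> * \<beta> = 1"
  shows "mat_gf (ar2_mat W (- 2 * \<beta>) (- 1))
    = diag_poly (\<Sum>i\<le>W - 2. monom 1 i) * ([:1, [:2 * \<beta>:], 1:] * [:[:1, 2 * \<beta>, 1:]:])"
proof (intro poly_eqI)
  fix i j
  have r: "coeff (\<Sum>i\<le>W - 2. monom (1::real) i) k = (if k \<le> W - 2 then 1 else 0)" for k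
    by (simp add: coeff_sum)
  show "coeff (coeff (mat_gf (ar2_mat W (- 2 * \<beta>) (- 1))) i) j = coeff (coeff
    (diag_poly (\<Sum>i\<le>W - 2. monom 1 i) * ([:1, [:2 * \<beta>:], 1:] * [:[:1, 2 * \<beta>, 1:]:])) i) j"
  proof (cases "W = 2")
    case True
    have "i = 0 \<or> i = 1 \<or> i = 2 \<or> i \<ge> 3" "j = 0 \<or> j = 1 \<or> j = 2 \<or> j \<ge> 3" by auto
    with True \<beta> show ?thesis
      unfolding coeff_diag_poly_five_diagonal[OF \<beta>] r
      by (elim disjE)
        (simp_all add: coeff_mat_gf ar2_mat_def mat_of_rows_list_def power2_eq_square)
  next
    case False
    \<comment> \<open>Writing W as n + 3 turns the boundary tests at W - 1 and W - 2 into
      comparisons free of truncated subtraction.\<close>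
    define n where "n = W - 3"
    have n: "W = Suc (Suc (Suc n))" using W False by (simp add: n_def)
    have \<beta>4: "(- 2 * \<beta>)\<^sup>2 = 4" using \<beta> by (simp add: power2_eq_square)
    have ar2: "coeff (coeff (mat_gf (ar2_mat W (- 2 * \<beta>) (- 1))) i) j =
        (if i \<le> W \<and> j \<le> W then ar2_diag_entry W (- 2 * \<beta>) (- 1) (max i j - min i j) (min i j) else 0)"
      using False by (auto simp: coeff_mat_gf ar2_mat_def)
    note ar2' = ar2[unfolded ar2_diag_entry_def \<beta>4]
    consider "j + 2 < i" | "i = Suc (Suc j)" | "i = Suc j" | "j = i" | "j = Suc i" | "j = Suc (Suc i)"
      | "j > i + 2"
      by linarith
    then show ?thesis
    proof cases
      case 3
      then show ?thesis
        unfolding coeff_diag_poly_five_diagonal[OF \<beta>] r ar2' unfolding n by (cases j) auto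
    next
      case 4
      have "i = 0 \<or> i = 1 \<or> (\<exists>k. i = Suc (Suc k))" by presburger
      with 4 show ?thesis
        unfolding coeff_diag_poly_five_diagonal[OF \<beta>] r ar2' unfolding n by (elim disjE exE) auto
    next
      case 5
      then show ?thesis
        unfolding coeff_diag_poly_five_diagonal[OF \<beta>] r ar2' unfolding n by (cases i) auto
    qed (unfold coeff_diag_poly_five_diagonal[OF \<beta>] r ar2', auto simp: n)
  qed
qed

theorem corollary6:
  fixes W :: nat and \<phi>\<^sub>1 \<phi>\<^sub>2 \<beta> :: real
    and p q :: "real poly" and A B :: nat and MA MB :: "real mat"
  assumes "W \<ge> 2"
    and "\<bar>\<phi>\<^sub>1\<bar> = 2" and "\<phi>\<^sub>2 = -1"
    and "(\<Sum>i\<le>W - 2. monom 1 i) = p * q"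
    and "\<forall>i. coeff p i \<ge> 0" and "\<forall>i. coeff q i \<ge> 0"
    and "A = degree p + 1" and "B = degree q + 1"
    and "\<beta> = - \<phi>\<^sub>1 / 2"
    and "MA \<in> carrier_mat (A + 1) (A + 1)" and "symmetric_matrix MA" and "three_diagonal MA"
    and "diag_gf 0 MA = [:1, 1:] * p" and "diag_gf 1 MA = Polynomial.smult \<beta> p"
    and "MB \<in> carrier_mat (B + 1) (B + 1)" and "symmetric_matrix MB" and "three_diagonal MB"
    and "diag_gf 0 MB = [:1, 1:] * q" and "diag_gf 1 MB = Polynomial.smult \<beta> q"
  shows "nonneg_definite MA \<and> nonneg_definite MB \<and> ar2_mat W \<phi>\<^sub>1 \<phi>\<^sub>2 = MA \<star> MB"
proof -
  have "\<phi>\<^sub>1 = 2 \<or> \<phi>\<^sub>1 = - 2"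
    using assms(2) by linarith
  then have \<beta>2: "\<beta> * \<beta> = 1" and \<phi>: "\<phi>\<^sub>1 = - 2 * \<beta>"
    using assms(9) by auto
  have MA: "MA \<in> carrier_mat (degree p + 2) (degree p + 2)"
    and MB: "MB \<in> carrier_mat (degree q + 2) (degree q + 2)"
    using assms(7,8,10,15) by simp_all
  note A = MA assms(11-14) \<beta>2 and B = MB assms(16-19) \<beta>2
  \<comment> \<open>Comparing degrees gives W = A + B, which puts both sides of the claimed identity
    into the same carrier.\<close>
  have "W - 2 = degree (p * q)"
    unfolding assms(4)[symmetric]
    by (rule order.antisym[OF le_degree degree_sum_le]) (auto simp: coeff_sum degree_monom_eq)
  also have "p * q \<noteq> 0"
    using arg_cong[OF assms(4), of "\<lambda>r. coeff r 0"] by (auto simp: coeff_sum)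
  then have "degree (p * q) = degree p + degree q"
    by (simp add: degree_mult_eq)
  finally have AB: "W = A + B"
    using assms(1,7,8) by simp
  have sq: "[:1, [:\<beta>:]:] * [:1, [:\<beta>:]:] = [:1, [:2 * \<beta>:], 1:]" "[:1, \<beta>:] * [:1, \<beta>:] = [:1, 2 * \<beta>, 1:]"
    using \<beta>2 by (simp_all add: one_pCons)
  have "mat_gf (MA \<star> MB) = mat_gf MA * mat_gf MB"
    by (rule mat_gf_conv[OF assms(10,15)])
  \<comment> \<open>The factors are regrouped so that the kernels in s and in t become squares,
    which \<open>sq\<close> expands into the kernels of \<open>ar2_mat_gf\<close>.\<close>
  also have "\<dots> = diag_poly (p * q) * (([:1, [:\<beta>:]:] * [:1, [:\<beta>:]:]) * ([:[:1, \<beta>:]:] * [:[:1, \<beta>:]:]))"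
    unfolding three_diagonal_mat_gf[OF A] three_diagonal_mat_gf[OF B] diag_poly_mult
    by (simp only: mult_ac)
  also have "[:[:1, \<beta>:]:] * [:[:1, \<beta>:]:] = [:[:1, \<beta>:] * [:1, \<beta>:]:]"
    by simp
  finally have "mat_gf (MA \<star> MB) = mat_gf (ar2_mat W \<phi>\<^sub>1 \<phi>\<^sub>2)"
    unfolding ar2_mat_gf[OF assms(1) \<beta>2] assms(3) assms(4)[symmetric] \<phi> sq by simp
  moreover have "ar2_mat W \<phi>\<^sub>1 \<phi>\<^sub>2 \<in> carrier_mat (W + 1) (W + 1)"
    by (auto simp: ar2_mat_def mat_of_rows_list_def)
  moreover have "MA \<star> MB \<in> carrier_mat (W + 1) (W + 1)"
    using assms(10,15) AB by (auto simp: mat_conv_def Let_def)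
  ultimately have "ar2_mat W \<phi>\<^sub>1 \<phi>\<^sub>2 = MA \<star> MB"
    using mat_gf_inject by metis
  then show ?thesis
    using three_diagonal_nonneg_definite[OF A] three_diagonal_nonneg_definite[OF B] assms(5,6) by blast
qed

end
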